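(* Let $n\ge 1$ be an integer and set $\rho=n$, $\sigma=1$. Let $x\in A$ be an element such that $v_{\rho,\sigma}(x)\geq \rho+\sigma=n+1$, and let $f\in\mathbb F[X,Y]$ be its $(\rho,\sigma)$-polynomial. If $f$ is not equal to $f_1^m$ for any $f_1\in\mathbb F[X,Y]$ and any integer $m>1$, then $x$ is unsolvable.
   Context: $\mathbb F$ is a field of characteristic zero and $A$ is the (first) Weyl algebra over $\mathbb F$: the associative unital $\mathbb F$-algebra generated by $p,q$ subject to $[p,q]=pq-qp=1$; the elements $p^iq^j$ ($i,j\ge 0$) form a basis of $A$. For $x=\sum\alpha_{ij}p^iq^j\in A$ let $E(x)=\{(i,j):\alpha_{ij}\ne 0\}$, $v_{\rho,\sigma}(x)=\sup_{(i,j)\in E(x)}(i\rho+j\sigma)$ (with $v_{\rho,\sigma}(0)=-\infty$), and $E_{\rho,\sigma}(x)=\{(i,j)\in E(x): i\rho+j\sigma=v_{\rho,\sigma}(x)\}$. The $(\rho,\sigma)$-polynomial of $x$ is $\sum_{(i,j)\in E_{\rho,\sigma}(x)}\alpha_{ij}X^iY^j\in\mathbb F[X,Y]$. An element $x\in A$ is solvable if there is $y\in A$ with $[x,y]=xy-yx=1$, and unsolvable otherwise.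
   Formalization: The hypothesis is that f is not c·f_1^m for any constant c in F, any f_1 in F[X,Y] and any m>1; with only "f is not f_1^m" the claim fails, e.g. F=Q, x=q-p^2, y=-p, where [x,y]=1 but f=-X^2 is not a proper power. *)

theory Defs
  imports
    "HOL-Computational_Algebra.Polynomial"
    "HOL-Library.Poly_Mapping"
    "HOL-Library.Extended_Real"
begin

section \<open>The free algebra on two generators\<close>

datatype weyl_gen = Gen_p | Gen_q

datatype weyl_word = Word "weyl_gen list"

text \<open>
  With concatenation of words as addition, the convolution product that
  \<^theory>\<open>HOL-Library.Poly_Mapping\<close> puts on finitely supported functions turns
  \<open>weyl_word \<Rightarrow>\<^sub>0 'a\<close> into the free associative unital algebra on the two generators.
\<close>

instantiation weyl_word :: monoid_add
begin

definition zero_weyl_word :: weyl_word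
  where "zero_weyl_word = Word []"

fun plus_weyl_word :: "weyl_word \<Rightarrow> weyl_word \<Rightarrow> weyl_word"
  where "plus_weyl_word (Word u) (Word v) = Word (u @ v)"

instance
proof
  fix a b c :: weyl_word
  show "a + b + c = a + (b + c)" by (cases a; cases b; cases c) simp
  show "0 + a = a" by (cases a) (simp add: zero_weyl_word_def)
  show "a + 0 = a" by (cases a) (simp add: zero_weyl_word_def)
qed

end

definition free_p :: "weyl_word \<Rightarrow>\<^sub>0 'a::comm_ring_1"
  where "free_p = Poly_Mapping.single (Word [Gen_p]) 1"

definition free_q :: "weyl_word \<Rightarrow>\<^sub>0 'a::comm_ring_1"
  where "free_q = Poly_Mapping.single (Word [Gen_q]) 1"


section \<open>The Weyl algebra\<close>

inductive_set weyl_ideal :: "(weyl_word \<Rightarrow>\<^sub>0 'a::comm_ring_1) set" where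
  rel: "free_p * free_q - free_q * free_p - 1 \<in> weyl_ideal"
| add: "u \<in> weyl_ideal \<Longrightarrow> v \<in> weyl_ideal \<Longrightarrow> u + v \<in> weyl_ideal"
| mult_left: "u \<in> weyl_ideal \<Longrightarrow> a * u \<in> weyl_ideal"
| mult_right: "u \<in> weyl_ideal \<Longrightarrow> u * a \<in> weyl_ideal"

definition weyl_rel :: "(weyl_word \<Rightarrow>\<^sub>0 'a::comm_ring_1) \<Rightarrow> (weyl_word \<Rightarrow>\<^sub>0 'a) \<Rightarrow> bool"
  where "weyl_rel u v \<longleftrightarrow> u - v \<in> weyl_ideal"

lemma weyl_ideal_zero: "0 \<in> weyl_ideal"
  using weyl_ideal.mult_left[OF weyl_ideal.rel, of 0] by simp

lemma weyl_ideal_uminus: "u \<in> weyl_ideal \<Longrightarrow> - u \<in> weyl_ideal"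
  using weyl_ideal.mult_left[of u "- 1"] by simp

lemma weyl_rel_add: "weyl_rel a b \<Longrightarrow> weyl_rel c d \<Longrightarrow> weyl_rel (a + c) (b + d)"
  unfolding weyl_rel_def using weyl_ideal.add[of "a - b" "c - d"] by (simp add: algebra_simps)

lemma weyl_rel_uminus: "weyl_rel a b \<Longrightarrow> weyl_rel (- a) (- b)"
  unfolding weyl_rel_def using weyl_ideal_uminus[of "a - b"] by simp

lemma weyl_rel_mult: "weyl_rel a b \<Longrightarrow> weyl_rel c d \<Longrightarrow> weyl_rel (a * c) (b * d)"
  unfolding weyl_rel_def
  using weyl_ideal.add[OF weyl_ideal.mult_right[of "a - b" c] weyl_ideal.mult_left[of "c - d" b]]
  by (simp add: algebra_simps)

lemma weyl_rel_refl: "weyl_rel a a"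
  by (simp add: weyl_rel_def weyl_ideal_zero)

lemma weyl_rel_sym: "weyl_rel a b \<Longrightarrow> weyl_rel b a"
  unfolding weyl_rel_def using weyl_ideal_uminus[of "a - b"] by simp

lemma weyl_rel_trans: "weyl_rel a b \<Longrightarrow> weyl_rel b c \<Longrightarrow> weyl_rel a c"
  unfolding weyl_rel_def using weyl_ideal.add[of "a - b" "b - c"] by simp

lemma equivp_weyl_rel: "equivp weyl_rel"
  by (rule equivpI) (auto simp: reflp_def symp_def transp_def
      intro: weyl_rel_refl weyl_rel_sym weyl_rel_trans)

quotient_type (overloaded) 'a weyl = "weyl_word \<Rightarrow>\<^sub>0 ('a::comm_ring_1)" / weyl_rel
  by (rule equivp_weyl_rel)

instantiation weyl :: (comm_ring_1) ring
begin

lift_definition zero_weyl :: "'a weyl" is 0 .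
lift_definition plus_weyl :: "'a weyl \<Rightarrow> 'a weyl \<Rightarrow> 'a weyl" is "(+)" by (rule weyl_rel_add)
lift_definition uminus_weyl :: "'a weyl \<Rightarrow> 'a weyl" is uminus by (rule weyl_rel_uminus)
lift_definition times_weyl :: "'a weyl \<Rightarrow> 'a weyl \<Rightarrow> 'a weyl" is "(*)" by (rule weyl_rel_mult)
definition minus_weyl :: "'a weyl \<Rightarrow> 'a weyl \<Rightarrow> 'a weyl" where "minus_weyl x y = x + - y"

instance
  by standard
    (unfold minus_weyl_def, (transfer, simp add: algebra_simps weyl_rel_refl)+)

end

lift_definition weyl_p :: "'a::comm_ring_1 weyl" is free_p .
lift_definition weyl_q :: "'a::comm_ring_1 weyl" is free_q .
lift_definition weyl_scale :: "'a::comm_ring_1 \<Rightarrow> 'a weyl \<Rightarrow> 'a weyl"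
  is "\<lambda>c u. Poly_Mapping.single 0 c * u"
  by (intro weyl_rel_mult weyl_rel_refl)


text \<open>
  The representation of the algebra on \<open>'a[X][Y]\<close> in which \<open>p\<close> is multiplication by the
  outer variable \<open>X\<close> and \<open>q\<close> is \<open>Y - d/dX\<close> with \<open>Y\<close> the inner variable; it maps
  \<open>p^i q^j\<close> applied to \<open>1\<close> to \<open>X^i Y^j\<close>. It is only used to prove linear independence.
\<close>

fun gen_act :: "weyl_gen \<Rightarrow> 'a::idom poly poly \<Rightarrow> 'a poly poly" where
  "gen_act Gen_p f = pCons 0 f"
| "gen_act Gen_q f = smult [:0, 1:] f - pderiv f"

fun word_act :: "weyl_word \<Rightarrow> 'a::idom poly poly \<Rightarrow> 'a poly poly" where
  "word_act (Word w) f = foldr gen_act w f"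

definition free_act :: "(weyl_word \<Rightarrow>\<^sub>0 'a::idom) \<Rightarrow> 'a poly poly \<Rightarrow> 'a poly poly" where
  "free_act u f = (\<Sum>w\<in>Poly_Mapping.keys u. smult [:Poly_Mapping.lookup u w:] (word_act w f))"

lemma gen_act_add: "gen_act g (a + b) = gen_act g a + gen_act g b"
  by (cases g) (simp_all add: pderiv_add smult_add_right)

lemma gen_act_smult: "gen_act g (smult [:c:] a) = smult [:c:] (gen_act g a)"
  by (cases g) (simp_all add: pderiv_smult smult_diff_right mult.commute)

lemma word_act_add: "word_act w (a + b) = word_act w a + word_act w b"
proof (cases w)
  case (Word l)
  have "foldr gen_act l (a + b) = foldr gen_act l a + foldr gen_act l b"
    by (induction l) (simp_all add: gen_act_add)
  then show ?thesis by (simp add: Word)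
qed

lemma word_act_smult: "word_act w (smult [:c:] a) = smult [:c:] (word_act w a)"
proof (cases w)
  case (Word l)
  have "foldr gen_act l (smult [:c:] a) = smult [:c:] (foldr gen_act l a)"
    by (induction l) (simp_all add: gen_act_smult)
  then show ?thesis by (simp add: Word)
qed

lemma word_act_zero: "word_act w 0 = 0"
  using word_act_smult[of w 0 0] by simp

lemma word_act_plus: "word_act (v + w) f = word_act v (word_act w f)"
  by (cases v; cases w) simp

lemma free_act_superset:
  assumes "finite S" "Poly_Mapping.keys u \<subseteq> S"
  shows "free_act u f = (\<Sum>w\<in>S. smult [:Poly_Mapping.lookup u w:] (word_act w f))"
  unfolding free_act_def using assms
  by (intro sum.mono_neutral_left) (auto simp: in_keys_iff)

lemma free_act_add: "free_act (u + v) f = free_act u f + free_act v f"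
proof -
  let ?S = "Poly_Mapping.keys u \<union> Poly_Mapping.keys v"
  have "Poly_Mapping.keys (u + v) \<subseteq> ?S" by (rule Poly_Mapping.keys_add)
  then show ?thesis
    by (simp add: free_act_superset[of ?S] lookup_add sum.distrib[symmetric]
        smult_add_left[symmetric])
qed

lemma free_act_single: "free_act (Poly_Mapping.single w c) f = smult [:c:] (word_act w f)"
  by (simp add: free_act_def)

lemma free_act_zero [simp]: "free_act 0 f = 0"
  by (simp add: free_act_def)

lemma free_act_uminus: "free_act (- u) f = - free_act u f"
  using free_act_add[of u "- u" f] by (simp add: eq_neg_iff_add_eq_0 add.commute)

lemma free_act_diff: "free_act (u - v) f = free_act u f - free_act v f"
  using free_act_add[of u "- v" f] by (simp add: free_act_uminus)

lemma free_act_add_right: "free_act u (f + g) = free_act u f + free_act u g"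
  by (simp add: free_act_def word_act_add smult_add_right sum.distrib)

lemma free_act_zero_right [simp]: "free_act u 0 = 0"
  by (simp add: free_act_def word_act_zero)

lemma free_alg_induct [case_names zero single_add]:
  fixes u :: "'k \<Rightarrow>\<^sub>0 'b::ab_group_add"
  assumes "P 0" "\<And>w c u. P u \<Longrightarrow> P (Poly_Mapping.single w c + u)"
  shows "P u"
proof (induction u rule: update_induct)
  case const
  then show ?case by (rule assms)
next
  case (update f a b)
  have "Poly_Mapping.update a b f = Poly_Mapping.single a b + f"
    using update.hyps
    by (intro poly_mapping_eqI)
      (auto simp: lookup_update lookup_add lookup_single when_def in_keys_iff)
  then show ?case using assms(2)[OF update.IH] by simp
qed

lemma free_act_single_mult:
  "free_act (Poly_Mapping.single w c * v) f = smult [:c:] (word_act w (free_act v f))"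
  by (induction v rule: free_alg_induct)
    (simp_all add: word_act_zero distrib_left free_act_add mult_single free_act_single
      word_act_plus word_act_add word_act_smult smult_add_right mult.commute)

lemma free_act_mult: "free_act (u * v) f = free_act u (free_act v f)"
  by (induction u rule: free_alg_induct)
    (simp_all add: distrib_right free_act_add free_act_single_mult free_act_single)

lemma free_act_one [simp]: "free_act 1 f = f"
proof -
  have "word_act 0 f = f" by (simp add: zero_weyl_word_def)
  then show ?thesis using free_act_single[of 0 1 f] by (simp add: one_pCons[symmetric])
qed

lemma free_act_p: "free_act free_p f = pCons 0 f"
  by (simp add: free_p_def free_act_single one_pCons[symmetric])

lemma free_act_q: "free_act free_q f = smult [:0, 1:] f - pderiv f"
  by (simp add: free_q_def free_act_single one_pCons[symmetric])

lemma free_act_ideal: "u \<in> weyl_ideal \<Longrightarrow> free_act u f = 0"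
proof (induction u arbitrary: f rule: weyl_ideal.induct)
  case rel
  show ?case
    by (simp add: free_act_diff free_act_mult free_act_p free_act_q pderiv_pCons)
qed (simp_all add: free_act_add free_act_mult)

lift_definition weyl_act :: "'a::idom weyl \<Rightarrow> 'a poly poly \<Rightarrow> 'a poly poly" is free_act
proof
  fix u v :: "weyl_word \<Rightarrow>\<^sub>0 'a" and f
  assume "weyl_rel u v"
  then show "free_act u f = free_act v f"
    using free_act_ideal[of "u - v" f] by (simp add: weyl_rel_def free_act_diff)
qed

instantiation weyl :: (idom) ring_1
begin

lift_definition one_weyl :: "'a weyl" is 1 .

instance
proof
  fix x :: "'a weyl"
  show "1 * x = x" by transfer (simp add: weyl_rel_refl)
  show "x * 1 = x" by transfer (simp add: weyl_rel_refl)
  have "weyl_act (0 :: 'a weyl) 1 = 0" by transfer simp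
  moreover have "weyl_act (1 :: 'a weyl) 1 = 1" by transfer simp
  ultimately show "(0 :: 'a weyl) \<noteq> 1" by (metis zero_neq_one)
qed

end

lemma weyl_commutator: "weyl_p * weyl_q - weyl_q * weyl_p = (1 :: 'a::idom weyl)"
proof -
  have "weyl_p * weyl_q + - (weyl_q * weyl_p) = (1 :: 'a weyl)"
    by transfer (use weyl_ideal.rel in \<open>simp add: weyl_rel_def\<close>)
  then show ?thesis by simp
qed

lemma single_zero_commute:
  fixes u :: "'k::monoid_add \<Rightarrow>\<^sub>0 'a::comm_ring_1"
  shows "Poly_Mapping.single 0 c * u = u * Poly_Mapping.single 0 c"
  by (induction u rule: free_alg_induct)
    (simp_all add: distrib_left distrib_right mult_single mult.commute)

lemma weyl_scale_mult_left: "weyl_scale c x * y = weyl_scale c (x * y)"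
  by transfer (simp add: mult.assoc weyl_rel_refl)

lemma weyl_scale_mult_right: "x * weyl_scale c y = weyl_scale c (x * y)"
proof (transfer, goal_cases)
  case (1 u c v)
  have "u * (Poly_Mapping.single 0 c * v) = Poly_Mapping.single 0 c * (u * v)"
    by (metis mult.assoc single_zero_commute)
  then show ?case by (simp add: weyl_rel_refl)
qed

global_interpretation weyl: vector_space "weyl_scale :: 'a::field \<Rightarrow> 'a weyl \<Rightarrow> 'a weyl"
proof
  fix a b :: 'a and x y :: "'a weyl"
  show "weyl_scale a (x + y) = weyl_scale a x + weyl_scale a y"
    by transfer (simp add: distrib_left weyl_rel_refl)
  show "weyl_scale (a + b) x = weyl_scale a x + weyl_scale b x"
    by transfer (simp add: single_add distrib_right weyl_rel_refl)
  show "weyl_scale a (weyl_scale b x) = weyl_scale (a * b) x"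
    by transfer (simp add: mult.assoc[symmetric] mult_single weyl_rel_refl)
  show "weyl_scale 1 x = x"
    by transfer (simp add: weyl_rel_refl)
qed


section \<open>The monomial basis\<close>

definition weyl_monom :: "nat \<Rightarrow> nat \<Rightarrow> 'a::idom weyl"
  where "weyl_monom i j = weyl_p ^ i * weyl_q ^ j"

definition weyl_basis :: "'a::idom weyl set"
  where "weyl_basis = {weyl_monom i j | i j. True}"

lemma weyl_act_p: "weyl_act weyl_p f = pCons 0 f"
  by transfer (rule free_act_p)

lemma weyl_act_q: "weyl_act weyl_q f = smult [:0, 1:] f - pderiv f"
  by transfer (rule free_act_q)

lemma weyl_act_mult: "weyl_act (x * y) f = weyl_act x (weyl_act y f)"
  by transfer (rule free_act_mult)

lemma weyl_act_one: "weyl_act 1 f = f"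
  by transfer simp

lemma weyl_act_zero: "weyl_act 0 f = 0"
  by transfer simp

lemma weyl_act_add: "weyl_act (x + y) f = weyl_act x f + weyl_act y f"
  by transfer (rule free_act_add)

lemma weyl_act_scale: "weyl_act (weyl_scale c x) f = smult [:c:] (weyl_act x f)"
  by transfer (simp add: free_act_single_mult zero_weyl_word_def)

lemma weyl_act_sum: "weyl_act (sum g S) f = (\<Sum>s\<in>S. weyl_act (g s) f)"
  by (induction S rule: infinite_finite_induct) (simp_all add: weyl_act_zero weyl_act_add)

lemma weyl_act_monom: "weyl_act (weyl_monom i j) 1 = monom (monom 1 j) i"
proof -
  have q: "weyl_act (weyl_q ^ j) 1 = [:monom 1 j:]"
    by (induction j)
      (simp_all add: weyl_act_one weyl_act_mult weyl_act_q pderiv_pCons monom_Suc one_pCons)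
  have "weyl_act (weyl_p ^ i) f = monom 1 i * f" for f :: "'a poly poly"
    by (induction i) (simp_all add: weyl_act_one weyl_act_mult weyl_act_p monom_Suc)
  then show ?thesis
    by (simp add: weyl_monom_def weyl_act_mult q smult_monom mult.commute[of _ "[:_:]"])
qed

lemma weyl_monom_eq_iff: "weyl_monom i j = (weyl_monom k l :: 'a::idom weyl) \<longleftrightarrow> i = k \<and> j = l"
proof
  assume "weyl_monom i j = (weyl_monom k l :: 'a weyl)"
  then have "monom (monom 1 j) i = (monom (monom 1 l) k :: 'a poly poly)"
    by (metis weyl_act_monom)
  then show "i = k \<and> j = l"
    by (metis degree_monom_eq monom_eq_iff' monom_eq_0_iff zero_neq_one)
qed simp

lemma independent_weyl_basis: "weyl.independent (weyl_basis :: 'a::field weyl set)"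
  unfolding weyl.independent_explicit_finite_subsets
proof (intro allI impI ballI)
  fix S :: "'a weyl set" and c v
  assume S: "S \<subseteq> weyl_basis" "finite S" and sum0: "(\<Sum>v\<in>S. weyl_scale (c v) v) = 0" and v: "v \<in> S"
  from S v obtain i j where ij: "v = weyl_monom i j" by (auto simp: weyl_basis_def)
  have coeff: "coeff (coeff (weyl_act w 1) i) j = (if w = v then 1 else 0)" if "w \<in> S" for w
    using that S(1) by (auto simp: weyl_basis_def ij weyl_act_monom weyl_monom_eq_iff)
  have "0 = coeff (coeff (weyl_act (\<Sum>w\<in>S. weyl_scale (c w) w) 1) i) j"
    by (simp add: sum0 weyl_act_zero)
  also have "\<dots> = (\<Sum>w\<in>S. c w * coeff (coeff (weyl_act w 1) i) j)"
    by (simp add: weyl_act_sum weyl_act_scale coeff_sum)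
  also have "\<dots> = (\<Sum>w\<in>S. if w = v then c w else 0)"
    by (rule sum.cong) (auto simp: coeff)
  also have "\<dots> = c v" using S(2) v by simp
  finally show "c v = 0" by simp
qed

lemma weyl_q_p_power: "weyl_q * weyl_p ^ i =
    weyl_p ^ i * weyl_q - of_nat i * (weyl_p ^ (i - 1) :: 'a::idom weyl)"
proof (induction i)
  case (Suc i)
  have qp: "weyl_q * weyl_p = weyl_p * weyl_q - (1 :: 'a weyl)"
    using weyl_commutator[where 'a = 'a] by (simp add: algebra_simps)
  have "weyl_q * weyl_p ^ Suc i = weyl_p * (weyl_q * weyl_p ^ i) - (weyl_p ^ i :: 'a weyl)"
    by (simp add: mult.assoc[symmetric] qp left_diff_distrib)
  also have "\<dots> = weyl_p ^ Suc i * weyl_q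
      - weyl_p * (of_nat i * weyl_p ^ (i - 1)) - weyl_p ^ i"
    by (simp add: Suc.IH right_diff_distrib mult.assoc)
  also have "weyl_p * (of_nat i * weyl_p ^ (i - 1)) = (of_nat i * weyl_p ^ i :: 'a weyl)"
  proof (cases i)
    case (Suc k)
    show ?thesis unfolding Suc by (metis diff_Suc_1 mult.assoc mult_of_nat_commute power_Suc)
  qed simp
  finally show ?case by (simp add: algebra_simps)
qed simp

lemma weyl_of_nat: "of_nat k = weyl_scale (of_nat k) (1 :: 'a::field weyl)"
  by (induction k) (simp_all add: weyl.scale_left_distrib)

lemma weyl_monom_in_span: "weyl_monom i j \<in> weyl.span weyl_basis"
  by (rule weyl.span_base) (auto simp: weyl_basis_def)

lemma weyl_span_p: "x \<in> weyl.span weyl_basis \<Longrightarrow> weyl_p * x \<in> weyl.span weyl_basis"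
proof (induction rule: weyl.span_induct_alt)
  case (step c x y)
  then obtain i j where "x = weyl_monom i j" by (auto simp: weyl_basis_def)
  then have "weyl_p * x = weyl_monom (Suc i) j" by (simp add: weyl_monom_def mult.assoc)
  then show ?case using step
    by (simp add: distrib_left weyl_scale_mult_right weyl.span_add weyl.span_scale
        weyl_monom_in_span)
qed (simp add: weyl.span_zero)

lemma weyl_span_q: "x \<in> weyl.span weyl_basis \<Longrightarrow> weyl_q * x \<in> weyl.span weyl_basis"
proof (induction rule: weyl.span_induct_alt)
  case (step c x y)
  then obtain i j where "x = weyl_monom i j" by (auto simp: weyl_basis_def)
  then have "weyl_q * x = weyl_monom i (Suc j) - weyl_scale (of_nat i) (weyl_monom (i - 1) j)"
    by (simp add: weyl_monom_def mult.assoc[symmetric] weyl_q_p_power left_diff_distrib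
        weyl_of_nat weyl_scale_mult_left)
  then have "weyl_q * x \<in> weyl.span weyl_basis"
    by (simp add: weyl.span_diff weyl.span_scale weyl_monom_in_span)
  then show ?case using step
    by (simp add: distrib_left weyl_scale_mult_right weyl.span_add weyl.span_scale)
qed (simp add: weyl.span_zero)

lemma span_weyl_basis: "weyl.span weyl_basis = (UNIV :: 'a::field weyl set)"
proof -
  have word: "abs_weyl (Poly_Mapping.single (Word w) 1) \<in> weyl.span (weyl_basis :: 'a weyl set)"
    for w
  proof (induction w)
    case Nil
    have "abs_weyl (Poly_Mapping.single (Word []) 1) = (weyl_monom 0 0 :: 'a weyl)"
      by (simp add: weyl_monom_def zero_weyl_word_def[symmetric] one_weyl.abs_eq[symmetric])
    then show ?case using weyl_monom_in_span by metis
  next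
    case (Cons g w)
    have "abs_weyl (Poly_Mapping.single (Word (g # w)) 1) =
        (case g of Gen_p \<Rightarrow> weyl_p | Gen_q \<Rightarrow> weyl_q) *
        (abs_weyl (Poly_Mapping.single (Word w) 1) :: 'a weyl)"
      by (cases g) (simp_all add: weyl_p_def weyl_q_def free_p_def free_q_def
          times_weyl.abs_eq mult_single)
    then show ?case using weyl_span_p[OF Cons.IH] weyl_span_q[OF Cons.IH]
      by (cases g) simp_all
  qed
  have abs: "abs_weyl u \<in> weyl.span (weyl_basis :: 'a weyl set)" for u
  proof (induction u rule: free_alg_induct)
    case zero
    then show ?case by (simp add: zero_weyl_def[symmetric] weyl.span_zero)
  next
    case (single_add w c u)
    obtain l where l: "w = Word l" by (cases w)
    have "abs_weyl (Poly_Mapping.single w c + u) =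
        weyl_scale c (abs_weyl (Poly_Mapping.single w 1)) + abs_weyl u"
      by (simp add: plus_weyl.abs_eq weyl_scale.abs_eq mult_single)
    then show ?case using word[of l] single_add
      by (simp add: l weyl.span_add weyl.span_scale)
  qed
  have "x \<in> weyl.span (weyl_basis :: 'a weyl set)" for x
    by (induction x rule: weyl.abs_induct) (rule abs)
  then show ?thesis by auto
qed

definition weyl_coeff :: "'a::field weyl \<Rightarrow> nat \<Rightarrow> nat \<Rightarrow> 'a"
  where "weyl_coeff x i j = weyl.representation weyl_basis x (weyl_monom i j)"


section \<open>Weights and solvability\<close>

definition weyl_E :: "'a::field weyl \<Rightarrow> (nat \<times> nat) set"
  where "weyl_E x = {(i, j). weyl_coeff x i j \<noteq> 0}"

text \<open>The supremum is taken in the extended reals, so it is \<open>-\<infinity>\<close> for \<open>x = 0\<close>.\<close>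

definition weyl_v :: "real \<Rightarrow> real \<Rightarrow> 'a::field weyl \<Rightarrow> ereal"
  where "weyl_v \<rho> \<sigma> x = (SUP (i, j)\<in>weyl_E x. ereal (real i * \<rho> + real j * \<sigma>))"

definition weyl_E_top :: "real \<Rightarrow> real \<Rightarrow> 'a::field weyl \<Rightarrow> (nat \<times> nat) set"
  where "weyl_E_top \<rho> \<sigma> x =
    {(i, j)\<in>weyl_E x. ereal (real i * \<rho> + real j * \<sigma>) = weyl_v \<rho> \<sigma> x}"

text \<open>
  Bivariate polynomials over \<open>'a\<close> are elements of \<open>'a poly poly\<close> with \<open>X\<close> as the
  outer and \<open>Y\<close> as the inner variable: \<open>monom (monom a j) i\<close> is \<open>a X^i Y^j\<close>.
\<close>

definition weyl_poly :: "real \<Rightarrow> real \<Rightarrow> 'a::field weyl \<Rightarrow> 'a poly poly"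
  where "weyl_poly \<rho> \<sigma> x =
    (\<Sum>(i, j)\<in>weyl_E_top \<rho> \<sigma> x. monom (monom (weyl_coeff x i j) j) i)"

definition solvable :: "'a::field weyl \<Rightarrow> bool"
  where "solvable x \<longleftrightarrow> (\<exists>y. x * y - y * x = 1)"

abbreviation unsolvable :: "'a::field weyl \<Rightarrow> bool"
  where "unsolvable x \<equiv> \<not> solvable x"

lemma finite_weyl_E: "finite (weyl_E x)"
proof -
  let ?r = "weyl.representation weyl_basis x"
  have "finite {v. ?r v \<noteq> 0}" by (rule weyl.finite_representation)
  moreover have "inj_on (\<lambda>(i, j). weyl_monom i j) (weyl_E x)"
    by (auto simp: inj_on_def weyl_monom_eq_iff)
  moreover have "(\<lambda>(i, j). weyl_monom i j) ` weyl_E x \<subseteq> {v. ?r v \<noteq> 0}"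
    by (auto simp: weyl_E_def weyl_coeff_def)
  ultimately show ?thesis by (meson finite_imageD finite_subset)
qed

lemma weyl_expansion:
  "x = (\<Sum>(i, j)\<in>weyl_E x. weyl_scale (weyl_coeff x i j) (weyl_monom i j))"
proof -
  let ?r = "weyl.representation weyl_basis x"
  have "x = (\<Sum>v\<in>{v. ?r v \<noteq> 0}. weyl_scale (?r v) v)"
    by (rule weyl.sum_nonzero_representation_eq[OF independent_weyl_basis, symmetric])
      (simp add: span_weyl_basis)
  also have "{v. ?r v \<noteq> 0} = (\<lambda>(i, j). weyl_monom i j) ` weyl_E x"
    using weyl.representation_ne_zero[of weyl_basis x]
    by (fastforce simp: weyl_E_def weyl_coeff_def weyl_basis_def image_iff)
  also have "(\<Sum>v\<in>\<dots>. weyl_scale (?r v) v) =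
      (\<Sum>(i, j)\<in>weyl_E x. weyl_scale (weyl_coeff x i j) (weyl_monom i j))"
    by (subst sum.reindex)
      (auto simp: inj_on_def weyl_monom_eq_iff weyl_coeff_def intro!: sum.cong)
  finally show ?thesis .
qed

lemma weyl_coeff_add: "weyl_coeff (x + y) i j = weyl_coeff x i j + weyl_coeff y i j"
  by (simp add: weyl_coeff_def weyl.representation_add independent_weyl_basis span_weyl_basis)

lemma weyl_coeff_scale: "weyl_coeff (weyl_scale c x) i j = c * weyl_coeff x i j"
  by (simp add: weyl_coeff_def weyl.representation_scale independent_weyl_basis span_weyl_basis)

lemma weyl_coeff_monom: "weyl_coeff (weyl_monom k l) i j = (if i = k \<and> j = l then 1 else 0)"
proof -
  have "weyl_monom k l \<in> (weyl_basis :: 'a weyl set)" by (auto simp: weyl_basis_def)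
  then show ?thesis
    by (simp add: weyl_coeff_def weyl.representation_basis independent_weyl_basis weyl_monom_eq_iff)
qed


section \<open>Powers and constant factors\<close>

text \<open>
  When every constant has an \<open>m\<close>-th root, e.g. over an algebraically closed field, being a
  proper power and being a constant multiple of a proper power are the same.
\<close>

lemma proper_power_up_to_constant:
  fixes f :: "'a::field poly poly"
  assumes "\<And>(c :: 'a) m. m > 1 \<Longrightarrow> \<exists>d. d ^ m = c"
  shows "(\<exists>c f1 m. m > (1::nat) \<and> f = smult [:c:] (f1 ^ m)) \<longleftrightarrow>
    (\<exists>f1 m. m > (1::nat) \<and> f = f1 ^ m)" (is "?L \<longleftrightarrow> ?R")
proof
  assume ?L
  then obtain c f1 m where m: "m > (1::nat)" and f: "f = smult [:c:] (f1 ^ m)" by blast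
  obtain d where d: "d ^ m = c" using assms[OF m] by blast
  have "[:d:] ^ m = [:c:]" using d by (simp add: poly_const_pow)
  then have "f = smult [:d:] f1 ^ m" by (simp add: f smult_power)
  with m show ?R by blast
next
  assume ?R
  then obtain f1 m where "m > (1::nat)" "f = smult [:1:] (f1 ^ m)"
    by (auto simp: one_pCons[symmetric])
  then show ?L by blast
qed

text \<open>
  Over other fields they differ, and the difference matters: \<open>q - p^2\<close> is solvable
  over the rationals, although its leading polynomial \<open>- X^2\<close> is not a proper power there.
\<close>

lemma solvable_with_non_power_leading_poly:
  fixes n :: nat
  assumes n: "n \<ge> 1"
  defines "x \<equiv> weyl_monom 0 1 + weyl_scale (- 1) (weyl_monom 2 0) :: rat weyl"
  shows "weyl_v (real n) 1 x \<ge> ereal (real n + 1)"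
    and "\<nexists>f1 m. m > (1::nat) \<and> weyl_poly (real n) 1 x = f1 ^ m"
    and "solvable x"
proof -
  have coeff: "weyl_coeff x i j = (if i = 0 \<and> j = 1 then 1 else if i = 2 \<and> j = 0 then - 1 else 0)"
    for i j unfolding x_def weyl_coeff_add weyl_coeff_scale weyl_coeff_monom by simp
  have E: "weyl_E x = {(0, 1), (2, 0)}"
    by (auto simp: weyl_E_def coeff split: if_splits)
  have v: "weyl_v (real n) 1 x = ereal (2 * real n)"
    using n by (simp add: weyl_v_def E sup_max max_def bot_ereal_def)
  show "weyl_v (real n) 1 x \<ge> ereal (real n + 1)"
    using n by (simp add: v)
  have "2 * real n \<noteq> 1" using n by linarith
  then have "weyl_E_top (real n) 1 x = {(2, 0)}"
    by (auto simp: weyl_E_top_def E v)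
  then have f: "weyl_poly (real n) 1 x = monom (monom (- 1) 0) 2"
    by (simp add: weyl_poly_def coeff)
  show "\<nexists>f1 m. m > (1::nat) \<and> weyl_poly (real n) 1 x = f1 ^ m"
  proof safe
    fix f1 :: "rat poly poly" and m :: nat
    assume m: "m > 1" and "weyl_poly (real n) 1 x = f1 ^ m"
    then have eq: "f1 ^ m = monom (monom (- 1) 0) 2" using f by simp
    have "f1 \<noteq> 0" using eq m by (auto simp: power_0_left)
    then have "m * degree f1 = 2"
      using arg_cong[OF eq, of degree] by (simp add: degree_power_eq degree_monom_eq)
    then have "m dvd 2" by (metis dvd_triv_left)
    then have "m \<le> 2" by (rule dvd_imp_le) simp
    then have "m = 2" using m by simp
    have "lead_coeff (lead_coeff f1) ^ m = lead_coeff (lead_coeff (f1 ^ m))"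
      by (simp add: lead_coeff_power)
    also have "\<dots> = - 1" by (simp add: eq degree_monom_eq)
    finally show False using \<open>m = 2\<close> by (metis neg_0_le_iff_le not_one_le_zero zero_le_power2)
  qed
  have "x * (- weyl_p) - (- weyl_p) * x = weyl_p * weyl_q - weyl_q * weyl_p"
    by (simp add: x_def weyl_monom_def algebra_simps weyl_scale_mult_left
        weyl_scale_mult_right power2_eq_square)
  then show "solvable x"
    unfolding solvable_def using weyl_commutator by metis
qed

end

theory Submission
  imports Defs "HOL-Computational_Algebra.Polynomial_Factorial"
begin

text \<open>
  Let \<open>p\<close> have weight \<open>n\<close> and \<open>q\<close> weight \<open>1\<close>, and write \<open>f\<close>, \<open>g\<close> for the leading forms of \<open>x\<close>
  and \<open>y\<close>, of weights \<open>d\<close> and \<open>e\<close>.  The leading form of \<open>x y\<close> is \<open>f g\<close>, and the part of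
  \<open>[x, y]\<close> in weight \<open>d + e - (n + 1)\<close> is the Poisson bracket \<open>{f, g}\<close>, all other parts having
  smaller weight (\<open>symbol_commutator_approx\<close>).  Suppose \<open>[x, y] = 1\<close> where \<open>d \<ge> n + 1\<close>.  As \<open>y\<close> is
  not a constant, \<open>e > 0\<close>; hence \<open>d + e - (n + 1)\<close> exceeds \<open>0\<close>, the weight of \<open>1\<close>, so
  \<open>{f, g} = 0\<close>.

  Two homogeneous forms with vanishing bracket are algebraically dependent:  by Euler's identity,
  \<open>{f, g} = 0\<close> says that \<open>f^e\<close> and \<open>g^d\<close> have the same logarithmic derivative, so they are
  proportional.  By unique factorisation \<open>f\<close> and \<open>g\<close> are then, up to constants, powers of a common
  form, and because \<open>f\<close> is not a constant times a proper power, \<open>g = c f^k\<close>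
  (\<open>poisson_commuting_homogeneous\<close>).  Now \<open>y - c x^k\<close> has smaller weight than \<open>y\<close>, while its
  commutator with \<open>x\<close> is still \<open>1\<close>.  Infinite descent on \<open>e\<close> gives the contradiction
  (\<open>commutator_ne_one\<close>).

  The argument on forms takes place in one variable:  since \<open>Y\<close> has weight \<open>1\<close>, a form of given
  weight is determined by its value at \<open>Y = 1\<close>, and the only arithmetic required is that of
  polynomials in one variable over a field.
\<close>

section \<open>Weighted bivariate polynomials\<close>

text \<open>
  One set-valued notion serves both degree bounds and homogeneity: \<open>weights n u \<subseteq> {..d}\<close> says that
  all monomials of \<open>u\<close> have weight at most \<open>d\<close>, and \<open>weights n u \<subseteq> {d}\<close> that \<open>u\<close> is homogeneous of
  weight \<open>d\<close> or zero.  Weights are integers so that bounds such as \<open>d - 1\<close> may become negative,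
  in which case they force \<open>u = 0\<close>.
\<close>

definition weights :: "nat \<Rightarrow> 'a::zero poly poly \<Rightarrow> int set"
  where "weights n u = {int (n * i + j) | i j. coeff (coeff u i) j \<noteq> 0}"

lemma weightsI: "coeff (coeff u i) j \<noteq> 0 \<Longrightarrow> int (n * i + j) \<in> weights n u"
  by (auto simp: weights_def)

lemma weights_subsetI:
  assumes "\<And>i j. coeff (coeff u i) j \<noteq> 0 \<Longrightarrow> int (n * i + j) \<in> D"
  shows "weights n u \<subseteq> D"
  using assms by (auto simp: weights_def)

lemma weights_subset_singletonD:
  assumes "weights n u \<subseteq> {d}" and "coeff (coeff u i) j \<noteq> 0"
  shows "int (n * i + j) = d"
  using assms weightsI by blast

lemma weights_zero [simp]: "weights n 0 = {}"
  by (simp add: weights_def)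

lemma weights_eq_empty_iff: "weights n u = {} \<longleftrightarrow> u = 0"
proof
  assume e: "weights n u = {}"
  show "u = 0"
    by (intro poly_eqI) (use e in \<open>simp add: weights_def\<close>)
qed simp

lemma weights_add: "weights n u \<subseteq> D \<Longrightarrow> weights n v \<subseteq> D \<Longrightarrow> weights n (u + v) \<subseteq> D"
  by (rule weights_subsetI) (metis add_0 coeff_add subsetD weightsI)

lemma weights_uminus [simp]: "weights n (- u) = weights n (u :: 'a::ab_group_add poly poly)"
  by (simp add: weights_def)

lemma weights_diff:
  fixes u v :: "'a::ab_group_add poly poly"
  shows "weights n u \<subseteq> D \<Longrightarrow> weights n v \<subseteq> D \<Longrightarrow> weights n (u - v) \<subseteq> D"
  using weights_add[of n u D "- v"] by simp

lemma weights_sum: "(\<And>s. s \<in> S \<Longrightarrow> weights n (g s) \<subseteq> D) \<Longrightarrow> weights n (sum g S) \<subseteq> D"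
  by (induction S rule: infinite_finite_induct) (simp_all add: weights_add)

lemma weights_mult:
  fixes u v :: "'a::comm_semiring_0 poly poly"
  assumes "weights n u \<subseteq> D" "weights n v \<subseteq> E"
    and "\<And>a b. a \<in> D \<Longrightarrow> b \<in> E \<Longrightarrow> a + b \<in> G"
  shows "weights n (u * v) \<subseteq> G"
proof (rule weights_subsetI)
  fix i j assume "coeff (coeff (u * v) i) j \<noteq> 0"
  then obtain k l where kl: "k \<le> i" "l \<le> j"
    and "coeff (coeff u k) l * coeff (coeff v (i - k)) (j - l) \<noteq> 0"
    by (fastforce simp: coeff_mult coeff_sum elim!: sum.not_neutral_contains_not_neutral)
  then have "coeff (coeff u k) l \<noteq> 0" "coeff (coeff v (i - k)) (j - l) \<noteq> 0"
    by auto
  then have "int (n * k + l) \<in> D" "int (n * (i - k) + (j - l)) \<in> E"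
    using assms(1,2) weightsI by blast+
  moreover have "n * i + j = (n * k + l) + (n * (i - k) + (j - l))"
  proof -
    obtain k' l' where "i = k + k'" "j = l + l'" using kl le_Suc_ex by metis
    then show ?thesis by (simp add: algebra_simps)
  qed
  ultimately show "int (n * i + j) \<in> G"
    using assms(3) by (metis of_nat_add)
qed

lemma weights_mult_singleton:
  fixes u v :: "'a::comm_semiring_0 poly poly"
  shows "weights n u \<subseteq> {d} \<Longrightarrow> weights n v \<subseteq> {e} \<Longrightarrow> weights n (u * v) \<subseteq> {d + e}"
  by (erule weights_mult) auto

lemma weights_smult:
  fixes u :: "'a::comm_semiring_0 poly poly"
  assumes "weights n u \<subseteq> D"
  shows "weights n (smult [:c:] u) \<subseteq> D"
proof (rule weights_subsetI)
  fix i j assume "coeff (coeff (smult [:c:] u) i) j \<noteq> 0"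
  then have "coeff (coeff u i) j \<noteq> 0" by auto
  then show "int (n * i + j) \<in> D" using assms weightsI by blast
qed

lemma weights_monom: "weights n (monom (monom c j) i) \<subseteq> {int (n * i + j)}"
  by (rule weights_subsetI) (auto split: if_splits)

lemma weights_one: "weights n (1 :: 'a::comm_semiring_1 poly poly) \<subseteq> {0}"
  using weights_monom[of n 1 0 0] by (simp add: monom_0 one_pCons)

lemma weights_power:
  fixes u :: "'a::comm_semiring_1 poly poly"
  shows "weights n u \<subseteq> {d} \<Longrightarrow> weights n (u ^ k) \<subseteq> {int k * d}"
proof (induction k)
  case (Suc k)
  then show ?case using weights_mult_singleton[of n u d "u ^ k" "int k * d"] by (simp add: algebra_simps)
qed (simp add: weights_one)

lemma weights_pderiv:
  assumes "weights n u \<subseteq> D" "\<And>a. a \<in> D \<Longrightarrow> a - int n \<in> G"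
  shows "weights n (pderiv u) \<subseteq> G"
proof (rule weights_subsetI)
  fix i j assume "coeff (coeff (pderiv u) i) j \<noteq> 0"
  then have "coeff (coeff u (Suc i)) j \<noteq> 0"
    by (auto simp: coeff_pderiv of_nat_poly)
  then have "int (n * Suc i + j) \<in> D" using assms(1) weightsI by blast
  then show "int (n * i + j) \<in> G" using assms(2) by force
qed

text \<open>
  In \<open>'a[Y][X]\<close>, \<^const>\<open>pderiv\<close> differentiates with respect to the outer variable \<open>X\<close>; this is the
  derivative with respect to \<open>Y\<close>.
\<close>

definition pderiv_inner :: "'a::{comm_semiring_1,semiring_no_zero_divisors} poly poly \<Rightarrow> 'a poly poly"
  where "pderiv_inner u = map_poly pderiv u"

lemma coeff_pderiv_inner: "coeff (pderiv_inner u) i = pderiv (coeff u i)"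
  by (simp add: pderiv_inner_def coeff_map_poly)

lemma weights_pderiv_inner:
  assumes "weights n u \<subseteq> D" "\<And>a. a \<in> D \<Longrightarrow> a - 1 \<in> G"
  shows "weights n (pderiv_inner u) \<subseteq> G"
proof (rule weights_subsetI)
  fix i j assume "coeff (coeff (pderiv_inner u) i) j \<noteq> 0"
  then have "coeff (coeff u i) (Suc j) \<noteq> 0"
    by (auto simp: coeff_pderiv_inner coeff_pderiv)
  then have "int (n * i + Suc j) \<in> D" using assms(1) weightsI by blast
  then show "int (n * i + j) \<in> G" using assms(2) by force
qed

lemma pderiv_inner_add: "pderiv_inner (u + v) = pderiv_inner u + pderiv_inner v"
  by (rule poly_eqI) (simp add: coeff_pderiv_inner pderiv_add)

lemma pderiv_inner_zero [simp]: "pderiv_inner 0 = 0"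
  by (simp add: pderiv_inner_def)

lemma pderiv_inner_sum: "pderiv_inner (sum g S) = (\<Sum>s\<in>S. pderiv_inner (g s))"
  by (induction S rule: infinite_finite_induct) (simp_all add: pderiv_inner_add)

lemma pderiv_inner_smult: "pderiv_inner (smult [:c:] u) = smult [:c:] (pderiv_inner u)"
  by (rule poly_eqI) (simp add: coeff_pderiv_inner pderiv_smult)

lemma pderiv_inner_monom: "pderiv_inner (monom c i) = monom (pderiv c) i"
  by (rule poly_eqI) (simp add: coeff_pderiv_inner)

text \<open>The guard \<open>n * i \<le> d\<close> is there because \<open>d - n * i\<close> is truncated subtraction.\<close>

definition homogeneous_part :: "nat \<Rightarrow> nat \<Rightarrow> 'a::comm_monoid_add poly poly \<Rightarrow> 'a poly poly"
  where "homogeneous_part n d u = (\<Sum>i\<le>degree u.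
    monom (if n * i \<le> d then monom (coeff (coeff u i) (d - n * i)) (d - n * i) else 0) i)"

lemma coeff_homogeneous_part:
  "coeff (coeff (homogeneous_part n d u) i) j =
    (if n * i + j = d then coeff (coeff u i) j else 0)"
proof -
  have "coeff (homogeneous_part n d u) i = (\<Sum>k\<le>degree u. if k = i then
      (if n * i \<le> d then monom (coeff (coeff u i) (d - n * i)) (d - n * i) else 0) else 0)"
    unfolding homogeneous_part_def coeff_sum by (intro sum.cong) auto
  also have "\<dots> = (if n * i \<le> d then monom (coeff (coeff u i) (d - n * i)) (d - n * i) else 0)"
    by (auto simp: coeff_eq_0)
  finally show ?thesis by auto
qed

lemma weights_homogeneous_part: "weights n (homogeneous_part n d u) \<subseteq> {int d}"
  by (rule weights_subsetI) (auto simp: coeff_homogeneous_part split: if_splits)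

lemma weights_minus_homogeneous_part:
  fixes u :: "'a::ab_group_add poly poly"
  assumes "weights n u \<subseteq> {..int d}"
  shows "weights n (u - homogeneous_part n d u) \<subseteq> {..int d - 1}"
proof (rule weights_subsetI)
  fix i j assume "coeff (coeff (u - homogeneous_part n d u) i) j \<noteq> 0"
  then have "coeff (coeff u i) j \<noteq> 0" "n * i + j \<noteq> d"
    by (auto simp: coeff_homogeneous_part split: if_splits)
  moreover from this(1) have "int (n * i + j) \<le> int d" using assms weightsI by blast
  ultimately have "n * i + j < d" by (simp only: of_nat_le_iff)
  then have "int (n * i + j) < int d" by (simp only: of_nat_less_iff)
  then show "int (n * i + j) \<in> {..int d - 1}" by simp
qed

definition poisson :: "'a::idom poly poly \<Rightarrow> 'a poly poly \<Rightarrow> 'a poly poly"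
  where "poisson u v = pderiv u * pderiv_inner v - pderiv_inner u * pderiv v"

lemma poisson_add_left: "poisson (u + u') v = poisson u v + poisson u' v"
  by (simp add: poisson_def pderiv_add pderiv_inner_add algebra_simps)

lemma poisson_add_right: "poisson u (v + v') = poisson u v + poisson u v'"
  by (simp add: poisson_def pderiv_add pderiv_inner_add algebra_simps)

lemma weights_poisson:
  assumes "weights n u \<subseteq> D" "weights n v \<subseteq> E"
    and "\<And>a b. a \<in> D \<Longrightarrow> b \<in> E \<Longrightarrow> a + b - int n - 1 \<in> G"
  shows "weights n (poisson u v) \<subseteq> G"
proof -
  have X: "weights n (pderiv w) \<subseteq> (\<lambda>a. a - int n) ` S"
    if "weights n w \<subseteq> S" for w :: "'a poly poly" and S
    using that by (rule weights_pderiv) simp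
  have Y: "weights n (pderiv_inner w) \<subseteq> (\<lambda>a. a - 1) ` S"
    if "weights n w \<subseteq> S" for w :: "'a poly poly" and S
    using that by (rule weights_pderiv_inner) simp
  have G: "a - int n + (b - 1) \<in> G" "a - 1 + (b - int n) \<in> G" if "a \<in> D" "b \<in> E" for a b
    using assms(3)[OF that] by (simp_all add: algebra_simps)
  have "weights n (pderiv u * pderiv_inner v) \<subseteq> G"
    using X[OF assms(1)] Y[OF assms(2)] by (rule weights_mult) (auto intro: G)
  moreover have "weights n (pderiv_inner u * pderiv v) \<subseteq> G"
    using Y[OF assms(1)] X[OF assms(2)] by (rule weights_mult) (auto intro: G)
  ultimately show ?thesis unfolding poisson_def by (rule weights_diff)
qed

section \<open>Symbols of elements of the Weyl algebra\<close>

text \<open>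
  Applying \<open>x\<close> to the constant \<open>1\<close> in the representation \<^const>\<open>weyl_act\<close> replaces \<open>p^i q^j\<close> by
  \<open>X^i Y^j\<close>.  The symbol thus encodes all coefficients, and the symbol of a product is computed by a
  differential operator: \<open>symbol (x * y) = weyl_act x (symbol y)\<close>.
\<close>

definition symbol :: "'a::idom weyl \<Rightarrow> 'a poly poly"
  where "symbol x = weyl_act x 1"

lemma symbol_scale: "symbol (weyl_scale c x) = smult [:c:] (symbol x)"
  by (simp add: symbol_def weyl_act_scale)

lemma symbol_one: "symbol 1 = 1"
  by (simp add: symbol_def weyl_act_one)

lemma symbol_mult: "symbol (x * y) = weyl_act x (symbol y)"
  by (simp add: symbol_def weyl_act_mult)

lemma weyl_act_diff: "weyl_act (x - y) u = weyl_act x u - weyl_act y u"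
  using weyl_act_add[of "x - y" y u] by (simp add: algebra_simps)

lemma symbol_diff: "symbol (x - y) = symbol x - symbol y"
  by (simp add: symbol_def weyl_act_diff)

lemma weyl_act_expansion:
  "weyl_act x u = (\<Sum>(i, j)\<in>weyl_E x. smult [:weyl_coeff x i j:] (weyl_act (weyl_monom i j) u))"
  by (subst weyl_expansion) (simp add: weyl_act_sum weyl_act_scale case_prod_beta)

lemma symbol_monom: "symbol (weyl_monom i j) = monom (monom 1 j) i"
  by (simp add: symbol_def weyl_act_monom)

lemma coeff_symbol: "coeff (coeff (symbol x) i) j = weyl_coeff x i j"
proof -
  have "coeff (coeff (symbol x) i) j =
      (\<Sum>s\<in>weyl_E x. if s = (i, j) then weyl_coeff x i j else 0)"
    unfolding symbol_def weyl_act_expansion[of x 1] coeff_sum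
    by (intro sum.cong) (auto simp: weyl_act_monom split: if_splits)
  also have "\<dots> = weyl_coeff x i j"
    using finite_weyl_E[of x] by simp (simp add: weyl_E_def)
  finally show ?thesis .
qed

lemma symbol_inj: "symbol x = symbol y \<Longrightarrow> x = (y :: 'a::field weyl)"
proof -
  assume "symbol x = symbol y"
  then have "weyl_coeff x = weyl_coeff y" by (intro ext) (metis coeff_symbol)
  moreover from this have "weyl_E x = weyl_E y" by (simp add: weyl_E_def)
  ultimately show ?thesis by (subst (1 2) weyl_expansion) simp
qed

lemma weyl_act_p_power: "weyl_act (weyl_p ^ i) u = monom 1 i * u"
  by (induction i) (simp_all add: weyl_act_one weyl_act_mult weyl_act_p monom_Suc)

text \<open>
  As \<open>q\<close> acts by \<open>Y - d/dX\<close>, expanding \<open>q^j u\<close> gives \<open>Y^j u - j Y^(j-1) u'\<close> plus terms in which \<open>u\<close>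
  is differentiated at least twice.  Each differentiation replaces a factor \<open>Y\<close> (weight \<open>1\<close>) by
  \<open>d/dX\<close> (weight \<open>- n\<close>), so those terms lie lower by \<open>2 (n + 1)\<close>.
\<close>

lemma weyl_act_q_power_approx:
  fixes u :: "'a::idom poly poly"
  assumes "weights n u \<subseteq> {..e}"
  shows "weights n (weyl_act (weyl_q ^ j) u - smult (monom 1 j) u
    + smult (pderiv (monom 1 j)) (pderiv u)) \<subseteq> {..e + int j - 2 * (int n + 1)}"
proof -
  define r where "r j = weyl_act (weyl_q ^ j) u - smult (monom 1 j) u
    + smult (pderiv (monom 1 j)) (pderiv u)" for j
  have smult_eq: "smult c v = monom c 0 * v" for c and v :: "'a poly poly"
    by (simp add: monom_0)
  have weights_smult_monom: "weights n (smult (monom c k) v) \<subseteq> {..d + int k}"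
    if "weights n v \<subseteq> {..d}" for c k d and v :: "'a poly poly"
    unfolding smult_eq[of "monom c k"] using weights_monom that by (rule weights_mult) auto
  have u2: "weights n (pderiv (pderiv u)) \<subseteq> {..e - 2 * int n}"
    by (rule weights_pderiv, rule weights_pderiv[OF assms, where G = "{..e - int n}"]) auto
  have "weights n (r j) \<subseteq> {..e + int j - 2 * (int n + 1)}"
  proof (induction j)
    case 0
    have "r 0 = 0" by (simp add: r_def weyl_act_one one_pCons[symmetric] pderiv_monom)
    then show ?case by simp
  next
    case (Suc j)
    \<comment> \<open>The terms of orders \<open>0\<close> and \<open>1\<close> in \<open>(Y - d/dX) (Y^j u - j Y^(j-1) u')\<close> are the ones that
      \<open>r (Suc j)\<close> subtracts; one second-order term survives.\<close>
    have "r (Suc j) = smult [:0, 1:] (r j) - pderiv (r j)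
        + smult (pderiv (monom 1 j)) (pderiv (pderiv u))"
      unfolding r_def
      by (simp add: weyl_act_mult weyl_act_q pderiv_add pderiv_diff pderiv_smult
          smult_add_right smult_diff_right pderiv_monom monom_Suc[symmetric] smult_add_left[symmetric]
          add_monom algebra_simps)
        (cases j; simp add: add_monom)
    moreover have "weights n (smult [:0, 1:] (r j)) \<subseteq> {..e + int (Suc j) - 2 * (int n + 1)}"
      using weights_smult_monom[OF Suc, of 1 1] by (simp add: monom_Suc monom_0 algebra_simps)
    moreover have "weights n (pderiv (r j)) \<subseteq> {..e + int (Suc j) - 2 * (int n + 1)}"
      by (rule weights_pderiv[OF Suc]) auto
    moreover have "weights n (smult (pderiv (monom 1 j)) (pderiv (pderiv u)))
        \<subseteq> {..e + int (Suc j) - 2 * (int n + 1)}"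
    proof (cases j)
      case (Suc k)
      show ?thesis using weights_smult_monom[OF u2, of "of_nat j" k]
        by (simp add: Suc pderiv_monom algebra_simps)
    qed (simp add: pderiv_monom)
    ultimately show ?case by (metis weights_add weights_diff)
  qed
  then show ?thesis by (simp add: r_def)
qed

text \<open>
  The beginning of the composition formula for normally ordered symbols,
  \<open>x u = \<Sum>k. (-1)^k / k! (d/dY)^k (symbol x) (d/dX)^k u\<close>.  The first two terms suffice, since in
  the commutator the first cancels and the second yields the Poisson bracket.
\<close>

lemma weyl_act_approx:
  fixes x :: "'a::field weyl"
  assumes "weights n (symbol x) \<subseteq> {..d}" "weights n u \<subseteq> {..e}"
  shows "weights n (weyl_act x u - symbol x * u + pderiv_inner (symbol x) * pderiv u)
    \<subseteq> {..d + e - 2 * (int n + 1)}"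
proof -
  define r where "r x = weyl_act x u - symbol x * u + pderiv_inner (symbol x) * pderiv u"
    for x :: "'a weyl"
  have r_sum: "r x = (\<Sum>s\<in>weyl_E x. case s of (i, j) \<Rightarrow> smult [:weyl_coeff x i j:] (r (weyl_monom i j)))"
    unfolding r_def symbol_def
    by (subst (1 2 3) weyl_act_expansion[of x])
      (simp add: pderiv_inner_sum sum_distrib_right sum.distrib[symmetric]
        sum_subtractf[symmetric] case_prod_beta pderiv_inner_smult smult_add_right smult_diff_right)
  have "weights n (r (weyl_monom i j)) \<subseteq> {..d + e - 2 * (int n + 1)}" if "(i, j) \<in> weyl_E x" for i j
  proof -
    have "coeff (coeff (symbol x) i) j \<noteq> 0" using that by (simp add: coeff_symbol weyl_E_def)
    then have d: "int (n * i + j) \<le> d" using assms(1) weightsI by blast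
    have m: "monom c i * v = monom 1 i * smult c v" for c :: "'a poly" and v
    proof -
      have "monom c i * v = smult c (monom 1 i) * v" by (simp add: smult_monom)
      then show ?thesis by simp
    qed
    have "r (weyl_monom i j) = monom 1 i * (weyl_act (weyl_q ^ j) u - smult (monom 1 j) u
        + smult (pderiv (monom 1 j)) (pderiv u))"
      unfolding r_def symbol_monom pderiv_inner_monom
      unfolding weyl_monom_def weyl_act_mult weyl_act_p_power
      by (simp only: m[of "monom 1 j" u] m[of "pderiv (monom 1 j)" "pderiv u"]
          right_diff_distrib distrib_left)
    moreover have "weights n (monom 1 i :: 'a poly poly) \<subseteq> {int (n * i)}"
      using weights_monom[of n 1 0 i] by (simp add: monom_0 one_pCons)
    ultimately show ?thesis
      using weights_mult[OF _ weyl_act_q_power_approx[OF assms(2), of j],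
          of "monom 1 i" "{int (n * i)}" "{..d + e - 2 * (int n + 1)}"] d
      by auto
  qed
  then have "weights n (r x) \<subseteq> {..d + e - 2 * (int n + 1)}"
    unfolding r_sum by (intro weights_sum) (auto simp del: smult_pCons intro!: weights_smult)
  then show ?thesis by (simp add: r_def)
qed

lemma symbol_commutator_approx:
  fixes x y :: "'a::field weyl"
  assumes "weights n (symbol x) \<subseteq> {..d}" "weights n (symbol y) \<subseteq> {..e}"
  shows "weights n (symbol (x * y - y * x) - poisson (symbol x) (symbol y))
    \<subseteq> {..d + e - 2 * (int n + 1)}"
proof -
  have eq: "symbol (x * y - y * x) - poisson (symbol x) (symbol y) =
      (weyl_act x (symbol y) - symbol x * symbol y + pderiv_inner (symbol x) * pderiv (symbol y))
      - (weyl_act y (symbol x) - symbol y * symbol x + pderiv_inner (symbol y) * pderiv (symbol x))"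
    by (simp add: symbol_diff symbol_mult poisson_def algebra_simps)
  show ?thesis
    unfolding eq using weyl_act_approx[OF assms(2,1)]
    by (intro weights_diff weyl_act_approx[OF assms]) (simp add: add.commute)
qed

text \<open>
  Modulo lower weight, the symbol is multiplicative, so the leading form of \<open>x^k\<close> is the \<open>k\<close>-th power
  of that of \<open>x\<close>.
\<close>

lemma symbol_power_approx:
  fixes x :: "'a::field weyl"
  assumes "weights n (symbol x) \<subseteq> {..int d}"
  shows "weights n (symbol (x ^ k) - homogeneous_part n d (symbol x) ^ k) \<subseteq> {..int (k * d) - 1}"
proof (induction k)
  case 0
  then show ?case by (simp add: symbol_one)
next
  case (Suc k)
  let ?f = "homogeneous_part n d (symbol x)"
  let ?G = "{..int (Suc k * d) - 1}"
  have f: "weights n (?f ^ k) \<subseteq> {..int (k * d)}"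
    using weights_power[OF weights_homogeneous_part, of n d "symbol x" k] by auto
  have u: "weights n (symbol (x ^ k)) \<subseteq> {..int (k * d)}"
    using weights_add[OF subset_trans[OF Suc] f] by auto
  have "symbol (x ^ Suc k) - ?f ^ Suc k =
      (weyl_act x (symbol (x ^ k)) - symbol x * symbol (x ^ k)
        + pderiv_inner (symbol x) * pderiv (symbol (x ^ k)))
      - pderiv_inner (symbol x) * pderiv (symbol (x ^ k))
      + symbol x * (symbol (x ^ k) - ?f ^ k) + (symbol x - ?f) * ?f ^ k"
    by (simp add: symbol_mult algebra_simps)
  moreover have "weights n (weyl_act x (symbol (x ^ k)) - symbol x * symbol (x ^ k)
        + pderiv_inner (symbol x) * pderiv (symbol (x ^ k))) \<subseteq> ?G"
    using weyl_act_approx[OF assms u] by auto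
  moreover have "weights n (pderiv_inner (symbol x) * pderiv (symbol (x ^ k))) \<subseteq> ?G"
    by (rule weights_mult[OF weights_pderiv_inner[OF assms, of "{..int d - 1}"]
        weights_pderiv[OF u, of "{..int (k * d) - int n}"]]) auto
  moreover have "weights n (symbol x * (symbol (x ^ k) - ?f ^ k)) \<subseteq> ?G"
    by (rule weights_mult[OF assms Suc]) auto
  moreover have "weights n ((symbol x - ?f) * ?f ^ k) \<subseteq> ?G"
    by (rule weights_mult[OF weights_minus_homogeneous_part[OF assms] f]) auto
  ultimately show ?case by (metis weights_add weights_diff)
qed

section \<open>Proportional powers of polynomials in one variable\<close>

text \<open>
  The primes of \<open>M\<close> are cancelled one at a time: each divides \<open>b ^ k\<close>, hence \<open>b\<close>.  Only primality is
  used, so that for polynomials over a field any choice of associates among the prime factors will do.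
\<close>

lemma prod_prime_elems_power_dvd_power_imp_dvd:
  fixes b :: "'a::idom"
  assumes "\<And>q. q \<in># M \<Longrightarrow> prime_elem q" "k > 0" "prod_mset M ^ k dvd b ^ k"
  shows "prod_mset M dvd b"
  using assms
proof (induction M arbitrary: b)
  case (add q M)
  from add.prems have q: "prime_elem q" by simp
  from add.prems(3) have pow: "q ^ k * prod_mset M ^ k dvd b ^ k"
    by (simp add: power_mult_distrib)
  have "q dvd q ^ k" using \<open>k > 0\<close> by (simp add: dvd_power)
  then have "q dvd b ^ k" using pow by (meson dvd_mult_left dvd_trans)
  then obtain c where b: "b = q * c" using q prime_elem_dvd_power by blast
  have "q ^ k \<noteq> 0" using q by (simp add: prime_elem_def)
  then have "prod_mset M ^ k dvd c ^ k"
    using pow by (auto simp: b power_mult_distrib)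
  then have "prod_mset M dvd c" using add by simp
  then show ?case by (simp add: b)
qed simp

lemma poly_power_dvd_power_imp_dvd:
  fixes a b :: "'a::field poly"
  assumes "a ^ k dvd b ^ k" "k > 0"
  shows "a dvd b"
proof (cases "a = 0")
  case True
  then show ?thesis using assms by (simp add: power_0_left)
next
  case False
  obtain M where M: "prod_mset M = smult (inverse (lead_coeff a)) a"
      "\<And>q. q \<in># M \<Longrightarrow> prime_elem q"
    using field_poly_prod_mset_prime_factorization[OF False]
      field_poly_in_prime_factorization_imp_prime[of _ a] by blast
  have "prod_mset M ^ k dvd b ^ k"
    using assms False by (simp add: M(1) smult_power smult_dvd_iff)
  then have "prod_mset M dvd b"
    using M(2) \<open>k > 0\<close> prod_prime_elems_power_dvd_power_imp_dvd by blast
  then show ?thesis using False by (simp add: M(1) smult_dvd_iff)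
qed

text \<open>
  The hypothesis says that \<open>u / v\<close> has derivative zero.  To stay inside the polynomial ring, leading
  coefficients are compared: in characteristic zero \<open>w' v = w v'\<close> with \<open>w \<noteq> 0\<close> forces
  \<open>degree w = degree v\<close>.  The equation is linear in \<open>w\<close>, so it passes to \<open>u - c v\<close>, which must
  vanish when \<open>c\<close> is chosen to cancel the leading term.
\<close>

lemma proportional_if_same_log_derivative:
  fixes u v :: "'a::field_char_0 poly"
  assumes "pderiv u * v = u * pderiv v" "v \<noteq> 0"
  shows "\<exists>c. u = smult c v"
proof -
  have lc: "coeff (pderiv w * v) (degree w + degree v - 1) =
      of_nat (degree w) * (lead_coeff w * lead_coeff v)" for w v :: "'a poly"
  proof (cases "degree w = 0")
    case True
    then show ?thesis using pderiv_eq_0_iff[of w] by simp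
  next
    case False
    then have "degree (pderiv w) + degree v = degree w + degree v - 1"
      by (simp add: degree_pderiv)
    then show ?thesis
      using coeff_mult_degree_sum[of "pderiv w" v] False
      by (simp add: degree_pderiv coeff_pderiv mult.assoc)
  qed
  have same_degree: "degree w = degree v" if w: "pderiv w * v = w * pderiv v" "w \<noteq> 0" for w
  proof -
    have "of_nat (degree w) * (lead_coeff w * lead_coeff v) =
        (of_nat (degree v) * (lead_coeff v * lead_coeff w) :: 'a)"
      unfolding lc[symmetric] w(1)
      by (simp only: mult.commute[of w] add.commute[of "degree w"])
    then show ?thesis using assms(2) w(2) by simp
  qed
  show ?thesis
  proof (cases "u = 0")
    case True
    then have "u = smult 0 v" by simp
    then show ?thesis ..
  next
    case False
    let ?c = "lead_coeff u / lead_coeff v"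
    let ?w = "u - smult ?c v"
    have "?w = 0"
    proof (rule ccontr)
      assume "?w \<noteq> 0"
      moreover have "pderiv ?w * v = ?w * pderiv v"
        using assms(1) by (simp add: pderiv_diff pderiv_smult algebra_simps)
      ultimately have "degree ?w = degree v" by (rule same_degree[rotated])
      then have "coeff ?w (degree v) \<noteq> 0" using \<open>?w \<noteq> 0\<close> by (metis leading_coeff_0_iff)
      moreover have "degree u = degree v" using assms(1) False by (rule same_degree)
      ultimately show False using assms(2) by simp
    qed
    then show ?thesis by (metis eq_iff_diff_eq_0)
  qed
qed

text \<open>
  With \<open>D k = E l + 1\<close>, the rational function \<open>w = u^k / v^l\<close> satisfies \<open>w^D = c^l u\<close>.  A rational
  function with a polynomial power is a polynomial, which is
  \<open>poly_power_dvd_power_imp_dvd\<close>.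
\<close>

lemma base_is_power_if_coprime_powers_proportional:
  fixes u v :: "'a::field poly"
  assumes uv: "u ^ E = smult c (v ^ D)" and "coprime D E" "D > 0" "u \<noteq> 0"
  shows "\<exists>w b. u = smult b (w ^ D)"
proof -
  obtain k l where kl: "D * k = E * l + 1"
    using bezout_add_strong_nat[of D E] assms(2,3) coprime_common_divisor_nat[of D E] by blast
  have c: "c \<noteq> 0" using uv \<open>u \<noteq> 0\<close> by force
  have "v \<noteq> 0"
    using uv \<open>u \<noteq> 0\<close> \<open>D > 0\<close> by (auto simp: power_0_left)
  have "(u ^ k) ^ D = u ^ (E * l + 1)"
    by (metis kl mult.commute power_mult)
  also have "\<dots> = u * (u ^ E) ^ l"
    by (simp add: power_add power_mult)
  also have "\<dots> = (v ^ l) ^ D * smult (c ^ l) u"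
    by (simp add: uv smult_power power_mult[symmetric] mult.commute)
  finally have uk: "(u ^ k) ^ D = (v ^ l) ^ D * smult (c ^ l) u" .
  have "(v ^ l) ^ D dvd (u ^ k) ^ D" unfolding uk by (rule dvd_triv_left)
  then have "v ^ l dvd u ^ k" using \<open>D > 0\<close> by (rule poly_power_dvd_power_imp_dvd)
  then obtain w where "u ^ k = v ^ l * w" by blast
  then have "(v ^ l) ^ D * w ^ D = (v ^ l) ^ D * smult (c ^ l) u"
    using uk by (simp add: power_mult_distrib)
  then have "w ^ D = smult (c ^ l) u" using \<open>v \<noteq> 0\<close> by (metis mult_cancel_left power_not_zero)
  then have "u = smult (inverse (c ^ l)) (w ^ D)" using c by simp
  then show ?thesis by blast
qed

lemma powers_proportional_if_log_derivatives_proportional: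
  fixes u v :: "'a::field_char_0 poly"
  assumes "smult (of_nat E) (pderiv u * v) = smult (of_nat D) (u * pderiv v)" "v \<noteq> 0"
    "D > 0" "E > 0"
  shows "\<exists>c. u ^ E = smult c (v ^ D)"
proof (rule proportional_if_same_log_derivative)
  obtain D' E' where DE: "D = Suc D'" "E = Suc E'" using assms(3,4) by (metis gr0_conv_Suc)
  have "pderiv (u ^ E) * v ^ D = u ^ E' * v ^ D' * smult (of_nat E) (pderiv u * v)"
    unfolding DE pderiv_power_Suc by (simp add: mult_ac)
  also have "\<dots> = u ^ E * pderiv (v ^ D)"
    unfolding assms(1) unfolding DE pderiv_power_Suc by (simp add: mult_ac)
  finally show "pderiv (u ^ E) * v ^ D = u ^ E * pderiv (v ^ D)" .
  show "v ^ D \<noteq> 0" using assms(2) by simp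
qed

section \<open>Poisson-commuting forms\<close>

text \<open>
  Setting \<open>Y = 1\<close> maps the forms of weight \<open>d\<close> bijectively onto the polynomials \<open>w\<close> in \<open>X\<close> with
  \<open>n * degree w \<le> d\<close>: the power of \<open>Y\<close> that accompanies \<open>X^i\<close> must be \<open>d - n * i\<close>.
\<close>

definition dehomogenise :: "'a::comm_semiring_1 poly poly \<Rightarrow> 'a poly"
  where "dehomogenise u = map_poly (\<lambda>c. poly c 1) u"

lemma coeff_dehomogenise: "coeff (dehomogenise u) i = poly (coeff u i) 1"
  by (simp add: dehomogenise_def coeff_map_poly)

lemma dehomogenise_zero [simp]: "dehomogenise 0 = 0"
  by (simp add: dehomogenise_def)

lemma dehomogenise_one [simp]: "dehomogenise 1 = 1"
  by (simp add: dehomogenise_def)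

lemma dehomogenise_mult: "dehomogenise (u * v) = dehomogenise u * dehomogenise v"
  by (rule poly_eqI) (simp add: coeff_dehomogenise coeff_mult poly_sum)

lemma dehomogenise_power: "dehomogenise (u ^ k) = dehomogenise u ^ k"
  by (induction k) (simp_all add: dehomogenise_mult)

lemma dehomogenise_smult: "dehomogenise (smult [:c:] u) = smult c (dehomogenise u)"
  by (rule poly_eqI) (simp add: coeff_dehomogenise)

lemma dehomogenise_diff:
  "dehomogenise (u - v) = dehomogenise u - dehomogenise (v :: 'a::comm_ring_1 poly poly)"
  by (rule poly_eqI) (simp add: coeff_dehomogenise)

lemma dehomogenise_pderiv:
  "dehomogenise (pderiv u) = pderiv (dehomogenise (u :: 'a::idom poly poly))"
  by (rule poly_eqI) (simp add: coeff_dehomogenise coeff_pderiv of_nat_poly)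

lemma homogeneous_coeff:
  fixes u :: "'a::comm_semiring_1 poly poly"
  assumes "weights n u \<subseteq> {int d}"
  shows "coeff u i = (if n * i \<le> d then monom (poly (coeff u i) 1) (d - n * i) else 0)"
proof -
  have "coeff (coeff u i) j = 0" if "n * i + j \<noteq> d" for j
    using weights_subset_singletonD[OF assms] that by (metis of_nat_eq_iff)
  then have eq: "coeff u i =
      (if n * i \<le> d then monom (coeff (coeff u i) (d - n * i)) (d - n * i) else 0)"
    by (intro poly_eqI) auto
  have "poly (coeff u i) 1 = coeff (coeff u i) (d - n * i)" if "n * i \<le> d"
    using arg_cong[OF eq, of "\<lambda>p. poly p 1"] that by (simp only: poly_monom if_True) simp
  then show ?thesis using eq by presburger
qed

lemma dehomogenise_inj:
  assumes "weights n u \<subseteq> {int d}" "weights n v \<subseteq> {int d}" "dehomogenise u = dehomogenise v"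
  shows "u = v"
proof (rule poly_eqI)
  fix i
  have "poly (coeff u i) 1 = poly (coeff v i) 1"
    using assms(3) by (metis coeff_dehomogenise)
  then show "coeff u i = coeff v i"
    by (subst homogeneous_coeff[OF assms(1)])
      (simp only: homogeneous_coeff[OF assms(2), of i, symmetric])
qed

lemma degree_dehomogenise_le:
  assumes "weights n u \<subseteq> {int d}"
  shows "n * degree (dehomogenise u) \<le> d"
proof (cases "dehomogenise u = 0")
  case False
  then have "coeff u (degree (dehomogenise u)) \<noteq> 0"
    by (metis coeff_dehomogenise leading_coeff_0_iff poly_0)
  then show ?thesis using homogeneous_coeff[OF assms, of "degree (dehomogenise u)"]
    by (auto split: if_splits)
qed simp

lemma dehomogenise_surj:
  assumes "n * degree w \<le> d"
  shows "\<exists>u. weights n u \<subseteq> {int d} \<and> dehomogenise u = w"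
proof (intro exI conjI)
  define u where "u = (\<Sum>i\<le>degree w. monom (monom (coeff w i) (d - n * i)) i)"
  have "n * i \<le> d" if "i \<le> degree w" for i
    using assms that by (meson le_trans mult_le_mono2)
  then show "weights n u \<subseteq> {int d}"
    unfolding u_def by (intro weights_sum order_trans[OF weights_monom]) auto
  show "dehomogenise u = w"
    by (rule poly_eqI) (auto simp: u_def coeff_dehomogenise coeff_sum poly_monom coeff_eq_0)
qed

text \<open>Euler's identity \<open>n X u_X + Y u_Y = d u\<close>, evaluated at \<open>Y = 1\<close>.\<close>

lemma dehomogenise_pderiv_inner:
  fixes u :: "'a::idom poly poly"
  assumes "weights n u \<subseteq> {int d}"
  shows "dehomogenise (pderiv_inner u) =
    smult (of_nat d) (dehomogenise u) - smult (of_nat n) (pCons 0 (pderiv (dehomogenise u)))"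
proof (rule poly_eqI)
  fix i
  have "coeff (dehomogenise (pderiv_inner u)) i = (of_nat d - of_nat (n * i)) * poly (coeff u i) 1"
    unfolding coeff_dehomogenise coeff_pderiv_inner
  proof (cases "n * i \<le> d")
    case True
    then have eq: "coeff u i = monom (poly (coeff u i) 1) (d - n * i)"
      using homogeneous_coeff[OF assms, of i] by simp
    have "poly (pderiv (monom c (d - n * i))) 1 = (of_nat d - of_nat (n * i)) * c" for c :: 'a
      using True by (simp add: pderiv_monom poly_monom of_nat_diff del: of_nat_mult)
    then show "poly (pderiv (coeff u i)) 1 = (of_nat d - of_nat (n * i)) * poly (coeff u i) 1"
      using eq by metis
  next
    case False
    then have "coeff u i = 0" using homogeneous_coeff[OF assms, of i] by simp
    then show "poly (pderiv (coeff u i)) 1 = (of_nat d - of_nat (n * i)) * poly (coeff u i) 1"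
      by simp
  qed
  then show "coeff (dehomogenise (pderiv_inner u)) i = coeff (smult (of_nat d) (dehomogenise u)
      - smult (of_nat n) (pCons 0 (pderiv (dehomogenise u)))) i"
    by (cases i) (simp_all add: coeff_dehomogenise coeff_pderiv algebra_simps)
qed

text \<open>
  At \<open>Y = 1\<close>, with Euler's identity eliminating the derivatives in \<open>Y\<close>, the vanishing of the bracket
  becomes \<open>e u' v = d u v'\<close>.  For \<open>D\<close>, \<open>E\<close> the coprime parts of \<open>d\<close>, \<open>e\<close> it follows that \<open>u^E\<close> and
  \<open>v^D\<close> are proportional, so \<open>u\<close> is a constant times a \<open>D\<close>-th power.  The degree bound for forms is
  inherited by the \<open>D\<close>-th root, so the root comes from a form and \<open>f\<close> is itself a constant times a
  \<open>D\<close>-th power.  Hence \<open>D = 1\<close>, that is, \<open>d\<close> divides \<open>e\<close>.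
\<close>

lemma poisson_commuting_homogeneous:
  fixes f g :: "'a::field_char_0 poly poly"
  assumes f: "weights n f \<subseteq> {int d}" "f \<noteq> 0" "d > 0"
    and g: "weights n g \<subseteq> {int e}" "g \<noteq> 0" "e > 0"
    and "poisson f g = 0"
    and not_power: "\<And>c h m. m > 1 \<Longrightarrow> f \<noteq> smult [:c:] (h ^ m)"
  shows "\<exists>c k. e = k * d \<and> g = smult [:c:] (f ^ k)"
proof -
  define u v where "u = dehomogenise f" and "v = dehomogenise g"
  have "u \<noteq> 0" using dehomogenise_inj[OF f(1), of 0] f(2) by (auto simp: u_def)
  have "v \<noteq> 0" using dehomogenise_inj[OF g(1), of 0] g(2) by (auto simp: v_def)
  define D E m where "D = d div gcd d e" and "E = e div gcd d e" and "m = gcd d e"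
  have "m > 0" "d = m * D" "e = m * E" "coprime D E"
    using f(3) by (simp_all add: D_def E_def m_def div_gcd_coprime)
  moreover from this have "D > 0" "E > 0" using f(3) g(3) by (auto intro: gr0I)
  ultimately have m: "m > 0" "d = m * D" "e = m * E" "D > 0" "E > 0" "coprime D E"
    by blast+
  have "dehomogenise (poisson f g) = 0" using assms(7) by simp
  then have "smult (of_nat e) (pderiv u * v) = smult (of_nat d) (u * pderiv v)"
    by (simp add: poisson_def dehomogenise_diff dehomogenise_mult dehomogenise_pderiv
        dehomogenise_pderiv_inner[OF f(1)] dehomogenise_pderiv_inner[OF g(1)]
        u_def[symmetric] v_def[symmetric] algebra_simps)
  then have "smult (of_nat m) (smult (of_nat E) (pderiv u * v)) =
      smult (of_nat m) (smult (of_nat D) (u * pderiv v))"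
    by (simp add: m(2,3))
  then have "smult (of_nat E) (pderiv u * v) = smult (of_nat D) (u * pderiv v)"
    using m(1) by (metis of_nat_0_eq_iff not_gr_zero smult_cancel)
  then obtain c where c: "u ^ E = smult c (v ^ D)"
    using powers_proportional_if_log_derivatives_proportional \<open>v \<noteq> 0\<close> m by metis
  then obtain w b where w: "u = smult b (w ^ D)"
    using base_is_power_if_coprime_powers_proportional m \<open>u \<noteq> 0\<close> by metis
  have "b \<noteq> 0" "w \<noteq> 0" using w \<open>u \<noteq> 0\<close> m(4) by (auto simp: power_0_left)
  then have "n * (D * degree w) \<le> m * D"
    using degree_dehomogenise_le[OF f(1)] w by (simp add: u_def[symmetric] m(2) degree_power_eq)
  then have "n * degree w \<le> m" using m(4) by (simp add: mult.left_commute[of n] mult.commute[of m])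
  then obtain h where h: "weights n h \<subseteq> {int m}" "dehomogenise h = w"
    using dehomogenise_surj by blast
  have "f = smult [:b:] (h ^ D)"
  proof (rule dehomogenise_inj[OF f(1)])
    show "weights n (smult [:b:] (h ^ D)) \<subseteq> {int d}"
      using weights_smult[OF weights_power[OF h(1), of D]] by (simp add: m(2) mult.commute)
    show "dehomogenise f = dehomogenise (smult [:b:] (h ^ D))"
      using w h(2) by (simp add: dehomogenise_smult dehomogenise_power u_def del: smult_pCons)
  qed
  then have "D = 1" using not_power[of D b h] m(4) by linarith
  then have "e = E * d" and uE: "u ^ E = smult c v" using m(2,3) c by simp_all
  have "c \<noteq> 0" using uE \<open>u \<noteq> 0\<close> by force
  have "g = smult [:inverse c:] (f ^ E)"
  proof (rule dehomogenise_inj[OF g(1)])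
    show "weights n (smult [:inverse c:] (f ^ E)) \<subseteq> {int e}"
      using weights_smult[OF weights_power[OF f(1), of E]] by (simp add: \<open>e = E * d\<close>)
    show "dehomogenise g = dehomogenise (smult [:inverse c:] (f ^ E))"
      using uE \<open>c \<noteq> 0\<close>
      by (simp add: dehomogenise_smult dehomogenise_power u_def v_def del: smult_pCons)
  qed
  then show ?thesis using \<open>e = E * d\<close> by blast
qed

section \<open>Descent on the weight of a solution\<close>

text \<open>
  The number \<open>e\<close> only bounds the weight of \<open>y\<close> from above, so \<open>y = 0\<close> and vanishing homogeneous
  parts need no separate treatment: when \<open>g = 0\<close>, the descent step is the one with \<open>c = 0\<close>.
\<close>

lemma commutator_ne_one:
  fixes x y :: "'a::field_char_0 weyl"
  assumes n: "n \<ge> 1" and x: "weights n (symbol x) \<subseteq> {..int d}" "d \<ge> n + 1"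
    and f: "f = homogeneous_part n d (symbol x)" "f \<noteq> 0"
    and not_power: "\<And>c h m. m > 1 \<Longrightarrow> f \<noteq> smult [:c:] (h ^ m)"
    and y: "weights n (symbol y) \<subseteq> {..int e}"
  shows "x * y - y * x \<noteq> 1"
  using y
proof (induction e arbitrary: y rule: less_induct)
  case (less e)
  show ?case
  proof
    assume comm: "x * y - y * x = 1"
    define g where "g = homogeneous_part n e (symbol y)"
    \<comment> \<open>Subtracting \<open>c x^k\<close> preserves the commutator with \<open>x\<close>; were the weight to drop, the induction
      hypothesis would apply, or, when \<open>e = 0\<close>, the difference would vanish.\<close>
    have lower: "\<not> weights n (symbol (y - weyl_scale c (x ^ k))) \<subseteq> {..int e - 1}" for c k
    proof
      let ?y = "y - weyl_scale c (x ^ k)"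
      assume w: "weights n (symbol ?y) \<subseteq> {..int e - 1}"
      have "x * ?y - ?y * x = 1"
        using comm by (simp add: algebra_simps weyl_scale_mult_left weyl_scale_mult_right
            power_commutes)
      show False
      proof (cases e)
        case 0
        have "weights n (symbol ?y) \<subseteq> {}"
        proof
          fix a assume "a \<in> weights n (symbol ?y)"
          then have "a \<ge> 0" "a \<le> - 1" using w by (auto simp: 0 weights_def)
          then show "a \<in> {}" by simp
        qed
        then have "symbol ?y = 0" by (simp add: weights_eq_empty_iff)
        then have "?y = 0" using symbol_inj[of ?y 0] by (simp add: symbol_def weyl_act_zero)
        then show False using \<open>x * ?y - ?y * x = 1\<close> by simp
      next
        case (Suc e')
        then show False using less.IH[of e' ?y] w \<open>x * ?y - ?y * x = 1\<close> by simp
      qed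
    qed
    have "e > 0"
    proof (rule ccontr)
      assume "\<not> e > 0"
      then have e: "e = 0" by simp
      \<comment> \<open>An element of weight at most \<open>0\<close> is a constant, as both variables have positive weight.\<close>
      define c where "c = coeff (coeff (symbol y) 0) 0"
      have "weights n (symbol (y - weyl_scale c (x ^ 0))) \<subseteq> {..int e - 1}"
      proof (rule weights_subsetI)
        fix i j assume nz: "coeff (coeff (symbol (y - weyl_scale c (x ^ 0))) i) j \<noteq> 0"
        have coeff_one: "coeff (coeff (smult [:c:] 1) i) j = (if i = 0 \<and> j = 0 then c else 0)"
          by (auto simp: one_pCons coeff_pCons split: nat.splits)
        have ij: "(i, j) \<noteq> (0, 0)"
        proof
          assume "(i, j) = (0, 0)"
          then show False using nz by (simp add: symbol_diff symbol_scale symbol_one c_def)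
        qed
        then have "coeff (coeff (symbol y) i) j \<noteq> 0"
          using nz coeff_one by (auto simp: symbol_diff symbol_scale symbol_one simp del: smult_pCons)
        then have "int (n * i + j) \<in> {..int 0}" using less.prems weightsI e by blast
        then have "n * i + j \<le> 0" by (simp only: atMost_iff of_nat_le_iff)
        then show "int (n * i + j) \<in> {..int e - 1}" using ij n by simp
      qed
      then show False using lower by blast
    qed
    have fx: "weights n f \<subseteq> {int d}" and gy: "weights n g \<subseteq> {int e}"
      by (simp_all add: f g_def weights_homogeneous_part)
    have xf: "weights n (symbol x - f) \<subseteq> {..int d - 1}" and yg: "weights n (symbol y - g) \<subseteq> {..int e - 1}"
      using x(1) less.prems by (simp_all add: f g_def weights_minus_homogeneous_part)
    \<comment> \<open>\<open>?N\<close> is one less than the weight of \<open>{f, g}\<close>, and it is at least \<open>0\<close>, the weight of \<open>1\<close>.\<close>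
    let ?N = "int d + int e - int n - 2"
    have "poisson (symbol x) (symbol y) = poisson f g + poisson f (symbol y - g)
        + poisson (symbol x - f) (symbol y)"
      by (simp add: poisson_add_left[symmetric] poisson_add_right[symmetric])
    then have "poisson f g = 1 - (1 - poisson (symbol x) (symbol y)) - poisson f (symbol y - g)
        - poisson (symbol x - f) (symbol y)"
      by simp
    moreover have "weights n (1 - poisson (symbol x) (symbol y)) \<subseteq> {..?N}"
      using symbol_commutator_approx[OF x(1) less.prems] by (auto simp: comm symbol_one)
    moreover have "weights n (poisson f (symbol y - g)) \<subseteq> {..?N}"
      by (rule weights_poisson[OF fx yg]) auto
    moreover have "weights n (poisson (symbol x - f) (symbol y)) \<subseteq> {..?N}"
      by (rule weights_poisson[OF xf less.prems]) auto
    moreover have "weights n (1 :: 'a poly poly) \<subseteq> {..?N}"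
      using weights_one[of n] \<open>e > 0\<close> x(2) by force
    ultimately have "weights n (poisson f g) \<subseteq> {..?N}"
      by (metis weights_diff)
    moreover have "weights n (poisson f g) \<subseteq> {?N + 1}"
      by (rule weights_poisson[OF fx gy]) auto
    ultimately have "weights n (poisson f g) = {}" by force
    then have fg: "poisson f g = 0" by (simp add: weights_eq_empty_iff)
    have "g \<noteq> 0" using lower[of 0 0] yg by auto
    then obtain c k where ck: "e = k * d" "g = smult [:c:] (f ^ k)"
      using poisson_commuting_homogeneous[OF fx f(2) _ gy _ \<open>e > 0\<close> fg not_power] x(2) by fastforce
    have "symbol (y - weyl_scale c (x ^ k)) =
        (symbol y - g) - smult [:c:] (symbol (x ^ k) - f ^ k)"
      by (simp add: symbol_diff symbol_scale ck(2) smult_diff_right)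
    moreover have "weights n (smult [:c:] (symbol (x ^ k) - f ^ k)) \<subseteq> {..int e - 1}"
      using weights_smult[OF symbol_power_approx[OF x(1), of k]] by (simp add: f ck(1))
    ultimately show False using lower[of c k] yg by (simp add: weights_diff)
  qed
qed

text \<open>
  Translates the supremum and the leading polynomial in \<^const>\<open>weyl_v\<close> and \<^const>\<open>weyl_poly\<close>, which
  are taken over real weights, into the integer weights of the symbol.
\<close>

lemma symbol_leading_form:
  fixes x :: "'a::field weyl"
  assumes "weyl_E x \<noteq> {}"
  obtains d where "weyl_v (real n) 1 x = ereal (real d)"
    and "weights n (symbol x) \<subseteq> {..int d}"
    and "homogeneous_part n d (symbol x) \<noteq> 0"
    and "weyl_poly (real n) 1 x = homogeneous_part n d (symbol x)"
proof -
  let ?w = "\<lambda>(i, j). n * i + j"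
  define d where "d = Max (?w ` weyl_E x)"
  have le: "n * i + j \<le> d" if "(i, j) \<in> weyl_E x" for i j
    unfolding d_def using that finite_weyl_E[of x] by (intro Max_ge) force+
  have "d \<in> ?w ` weyl_E x"
    unfolding d_def using assms finite_weyl_E[of x] by (intro Max_in) auto
  then obtain i0 j0 where ij: "(i0, j0) \<in> weyl_E x" "n * i0 + j0 = d" by auto
  have weight: "real i * real n + real j * 1 = real (n * i + j)" for i j by simp
  have v: "weyl_v (real n) 1 x = ereal (real d)"
    unfolding weyl_v_def weight
  proof (rule antisym)
    show "(SUP (i, j)\<in>weyl_E x. ereal (real (n * i + j))) \<le> ereal (real d)"
      using le by (auto intro!: SUP_least simp del: of_nat_add of_nat_mult)
    show "ereal (real d) \<le> (SUP (i, j)\<in>weyl_E x. ereal (real (n * i + j)))"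
      using ij by (intro SUP_upper2[OF ij(1)]) auto
  qed
  have top: "weyl_E_top (real n) 1 x = {(i, j) \<in> weyl_E x. n * i + j = d}"
    unfolding weyl_E_top_def v weight
    by (auto simp del: of_nat_add of_nat_mult)
  have poly: "weyl_poly (real n) 1 x = homogeneous_part n d (symbol x)"
  proof (intro poly_eqI)
    fix i j
    have "finite (weyl_E_top (real n) 1 x)"
      unfolding top using finite_weyl_E[of x] by (rule finite_subset[rotated]) auto
    then have "coeff (coeff (weyl_poly (real n) 1 x) i) j =
        (\<Sum>s\<in>weyl_E_top (real n) 1 x. if s = (i, j) then weyl_coeff x i j else 0)"
      unfolding weyl_poly_def coeff_sum by (intro sum.cong) (auto split: if_splits)
    also have "\<dots> = (if (i, j) \<in> weyl_E_top (real n) 1 x then weyl_coeff x i j else 0)"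
      using \<open>finite (weyl_E_top (real n) 1 x)\<close> by simp
    also have "\<dots> = coeff (coeff (homogeneous_part n d (symbol x)) i) j"
      by (auto simp: top coeff_homogeneous_part coeff_symbol weyl_E_def)
    finally show "coeff (coeff (weyl_poly (real n) 1 x) i) j =
        coeff (coeff (homogeneous_part n d (symbol x)) i) j" .
  qed
  have "weights n (symbol x) \<subseteq> {..int d}"
    by (rule weights_subsetI) (use le in \<open>auto simp: coeff_symbol weyl_E_def simp flip: of_nat_mult of_nat_add\<close>)
  moreover have "coeff (coeff (homogeneous_part n d (symbol x)) i0) j0 \<noteq> 0"
    using ij by (simp add: coeff_homogeneous_part coeff_symbol weyl_E_def)
  then have "homogeneous_part n d (symbol x) \<noteq> 0" by auto
  ultimately show ?thesis using that v poly by blast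
qed

theorem theorem4p5:
  fixes n :: nat and \<rho> \<sigma> :: real
    and x :: "'a::field_char_0 weyl" and f :: "'a poly poly"
  assumes "n \<ge> 1"
    and "\<rho> = real n" and "\<sigma> = 1"
    and "weyl_v \<rho> \<sigma> x \<ge> ereal (\<rho> + \<sigma>)"
    and "f = weyl_poly \<rho> \<sigma> x"
    and "\<And>(c :: 'a) f1 (m :: nat). m > 1 \<Longrightarrow> f \<noteq> smult [:c:] (f1 ^ m)"
  shows "unsolvable x"
proof -
  have "weyl_E x \<noteq> {}"
    using assms(4) by (auto simp: weyl_v_def bot_ereal_def)
  then obtain d where d: "weyl_v (real n) 1 x = ereal (real d)"
      "weights n (symbol x) \<subseteq> {..int d}"
      "homogeneous_part n d (symbol x) \<noteq> 0"
      "weyl_poly (real n) 1 x = homogeneous_part n d (symbol x)"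
    by (rule symbol_leading_form)
  have f: "f = homogeneous_part n d (symbol x)" using assms(2,3,5) d(4) by simp
  have "d \<ge> n + 1" using assms(2-4) d(1) by simp
  have "x * y - y * x \<noteq> 1" for y
  proof -
    obtain e where "weights n (symbol y) \<subseteq> {..int e}"
    proof (cases "weyl_E y = {}")
      case True
      then have "weights n (symbol y) \<subseteq> {..int 0}"
        by (intro weights_subsetI) (simp add: coeff_symbol weyl_E_def)
      then show ?thesis by (rule that)
    next
      case False
      then show ?thesis by (rule symbol_leading_form) (rule that)
    qed
    then show ?thesis
      using commutator_ne_one[OF assms(1) d(2) \<open>d \<ge> n + 1\<close> f] d(3) assms(6) f by metis
  qed
  then show ?thesis by (simp add: solvable_def)
qed

end
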